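(* Let $\Gamma_1$ and $\Gamma_2$ be finite simple graphs and let $k_1,k_2$ be integers. (i) If $\Gamma_i$ contains a defensive $k_i$-alliance for each $i\in\{1,2\}$, then $\Gamma_1\times\Gamma_2$ contains a defensive $(k_1+k_2)$-alliance and $$a_{k_1+k_2}^{d}(\Gamma_1\times\Gamma_2)\le a_{k_1}^{d}(\Gamma_1)\,a_{k_2}^{d}(\Gamma_2).$$ (ii) If there exists a partition of $\Gamma_i$ into defensive $k_i$-alliances for each $i\in\{1,2\}$, then there exists a partition of $\Gamma_1\times\Gamma_2$ into defensive $(k_1+k_2)$-alliances and $$\psi_{k_1+k_2}^{d}(\Gamma_1\times\Gamma_2)\ge \psi_{k_1}^{d}(\Gamma_1)\,\psi_{k_2}^{d}(\Gamma_2).$$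
   Context: For a finite simple graph $\Gamma=(V,E)$, $X\subseteq V$ and $v\in V$, $\delta_X(v)$ is the number of neighbors of $v$ in $X$; $\bar S=V\setminus S$. A nonempty set $S\subseteq V$ is a defensive $k$-alliance if $\delta_S(v)\ge\delta_{\bar S}(v)+k$ for every $v\in S$, where $k$ is an integer in $\{-\Delta,\dots,\Delta\}$ and $\Delta$ is the maximum degree of $\Gamma$. $a_k^d(\Gamma)$ is the minimum cardinality of a defensive $k$-alliance in $\Gamma$ (when one exists). A partition of $\Gamma$ into defensive $k$-alliances is a partition of $V$ each of whose sets is a defensive $k$-alliance, and $\psi_k^{d}(\Gamma)$ is the maximum number of sets in such a partition. $\Gamma_1\times\Gamma_2$ denotes the Cartesian product: its vertex set is $V(\Gamma_1)\times V(\Gamma_2)$, and $(u,v)$ is adjacent to $(u',v')$ if and only if either $u=u'$ and $v$ is adjacent to $v'$ in $\Gamma_2$, or $v=v'$ and $u$ is adjacent to $u'$ in $\Gamma_1$. *)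

theory Defs
  imports "Graph_Theory.Graph_Theory" "HOL-Library.Disjoint_Sets"
begin

text \<open>
  Finite simple graphs are modelled by the locale \<^locale>\<open>pair_graph\<close>: an undirected edge
  between \<open>u\<close> and \<open>v\<close> is represented by the two arcs \<open>(u, v)\<close> and \<open>(v, u)\<close>.
\<close>

definition nbr_count :: "'a pair_pre_digraph \<Rightarrow> 'a set \<Rightarrow> 'a \<Rightarrow> nat" where
  "nbr_count G X v = card {w \<in> X. (v, w) \<in> parcs G}"

text \<open>
  As arcs come in symmetric pairs, the out-degree of a vertex is its degree. For the null graph
  the maximum degree is unspecified; it has no nonempty vertex set, so this is never relevant below.
\<close>

definition max_degree :: "'a pair_pre_digraph \<Rightarrow> nat" where
  "max_degree G = Max (out_degree (with_proj G) ` pverts G)"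

definition defensive_alliance :: "'a pair_pre_digraph \<Rightarrow> int \<Rightarrow> 'a set \<Rightarrow> bool" where
  "defensive_alliance G k S \<longleftrightarrow>
     k \<in> {- int (max_degree G)..int (max_degree G)} \<and>
     S \<noteq> {} \<and> S \<subseteq> pverts G \<and>
     (\<forall>v\<in>S. int (nbr_count G S v) \<ge> int (nbr_count G (pverts G - S) v) + k)"

text \<open>The following number is meaningful only if a defensive \<open>k\<close>-alliance exists.\<close>

definition defensive_alliance_number :: "int \<Rightarrow> 'a pair_pre_digraph \<Rightarrow> nat" where
  "defensive_alliance_number k G = Min (card ` {S. defensive_alliance G k S})"

definition defensive_alliance_partition ::
    "'a pair_pre_digraph \<Rightarrow> int \<Rightarrow> 'a set set \<Rightarrow> bool" where
  "defensive_alliance_partition G k P \<longleftrightarrow>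
     partition_on (pverts G) P \<and> (\<forall>S\<in>P. defensive_alliance G k S)"

text \<open>The following number is meaningful only if a partition into defensive \<open>k\<close>-alliances exists.\<close>

definition defensive_alliance_partition_number :: "int \<Rightarrow> 'a pair_pre_digraph \<Rightarrow> nat" where
  "defensive_alliance_partition_number k G =
     Max (card ` {P. defensive_alliance_partition G k P})"

definition cartesian_product ::
    "'a pair_pre_digraph \<Rightarrow> 'b pair_pre_digraph \<Rightarrow> ('a \<times> 'b) pair_pre_digraph" where
  "cartesian_product G H =
     \<lparr> pverts = pverts G \<times> pverts H,
       parcs = {((u, v), (u', v')) | u v u' v'.
         u \<in> pverts G \<and> v \<in> pverts H \<and> u' \<in> pverts G \<and> v' \<in> pverts H \<and>
         (u = u' \<and> (v, v') \<in> parcs H \<or> v = v' \<and> (u, u') \<in> parcs G)} \<rparr>"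

lemma pair_graph_cartesian_product:
  assumes "pair_graph G" and "pair_graph H"
  shows "pair_graph (cartesian_product G H)"
proof -
  interpret G: pair_graph G by fact
  interpret H: pair_graph H by fact
  let ?V = "pverts G \<times> pverts H"
  have sub: "parcs (cartesian_product G H) \<subseteq> ?V \<times> ?V"
    by (auto simp: cartesian_product_def)
  have fin: "finite ?V"
    using G.pair_finite_verts H.pair_finite_verts by simp
  have symG: "sym (parcs G)" and symH: "sym (parcs H)"
    using G.pair_sym_arcs H.pair_sym_arcs by (simp_all add: symmetric_def)
  have "sym (parcs (cartesian_product G H))"
    unfolding cartesian_product_def sym_def
    using symD[OF symG] symD[OF symH] by auto
  moreover have "finite (parcs (cartesian_product G H))"
    using finite_subset[OF sub] fin by blast
  moreover have "fst e \<noteq> snd e" if "e \<in> parcs (cartesian_product G H)" for e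
    using that G.pair_no_loops H.pair_no_loops
    by (fastforce simp: cartesian_product_def)
  moreover have "fst e \<in> pverts (cartesian_product G H)"
      "snd e \<in> pverts (cartesian_product G H)"
    if "e \<in> parcs (cartesian_product G H)" for e
    using that by (auto simp: cartesian_product_def)
  moreover have "finite (pverts (cartesian_product G H))"
    using fin by (simp add: cartesian_product_def)
  ultimately show ?thesis
    by unfold_locales (simp_all add: symmetric_def)
qed

end

theory Submission
  imports Defs
begin

text \<open>
  Write \<open>d\<^sub>X v\<close> for the number of neighbours of \<open>v\<close> in \<open>X\<close>, and \<open>d v\<close> for the degree of \<open>v\<close>.
  The defining inequality of a defensive \<open>k\<close>-alliance \<open>S\<close> is equivalent to
  \<open>d v + k \<le> 2 * d\<^sub>S v\<close> (lemma \<open>defensive_alliance_iff_degree\<close>). Inside a box \<open>S \<times> T\<close> containing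
  \<open>(u, v)\<close>, the neighbours of \<open>(u, v)\<close> in the Cartesian product are obtained by moving either
  \<open>u\<close> within \<open>S\<close> or \<open>v\<close> within \<open>T\<close>, so that \<open>d\<^sub>S\<^sub>\<times>\<^sub>T (u, v) = d\<^sub>S u + d\<^sub>T v\<close> (lemma
  \<open>nbr_count_cartesian_product\<close>). For \<open>S\<close> and \<open>T\<close> the full vertex sets this says that degrees add
  as well. Hence every term of the alliance inequality is additive, and adding the inequalities
  for \<open>S\<close> and \<open>T\<close> gives the one for \<open>S \<times> T\<close> with \<open>k = k\<^sub>1 + k\<^sub>2\<close>. The admissible range of \<open>k\<close>
  causes no trouble, because maximum degrees add too: a pair of vertices of maximum degree
  is a vertex of degree \<open>\<Delta>\<^sub>1 + \<Delta>\<^sub>2\<close>.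

  Both inequalities follow by taking products of optimal objects. The product of two minimum
  alliances is an alliance of size \<open>a\<^sub>1 * a\<^sub>2\<close>; the boxes formed from the blocks of two maximum
  partitions partition the vertices of the product into \<open>\<psi>\<^sub>1 * \<psi>\<^sub>2\<close> alliances.
\<close>

section \<open>Neighbour counts and degrees\<close>

lemma finite_nbrs:
  assumes "pair_graph G"
  shows "finite {w \<in> X. (v, w) \<in> parcs G}"
proof -
  interpret pair_graph G by fact
  have "{w \<in> X. (v, w) \<in> parcs G} \<subseteq> snd ` parcs G" by force
  then show ?thesis using pair_finite_arcs finite_surj by blast
qed

lemma nbr_count_add_complement:
  assumes "pair_graph G" "S \<subseteq> pverts G"
  shows "nbr_count G S v + nbr_count G (pverts G - S) v = nbr_count G (pverts G) v"
proof -
  have "{w \<in> pverts G. (v, w) \<in> parcs G} =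
      {w \<in> S. (v, w) \<in> parcs G} \<union> {w \<in> pverts G - S. (v, w) \<in> parcs G}"
    using assms(2) by auto
  also have "card \<dots> =
      card {w \<in> S. (v, w) \<in> parcs G} + card {w \<in> pverts G - S. (v, w) \<in> parcs G}"
    by (intro card_Un_disjoint finite_nbrs[OF assms(1)]) auto
  finally show ?thesis by (simp add: nbr_count_def)
qed

lemma out_degree_eq_nbr_count:
  assumes "pair_graph G"
  shows "out_degree (with_proj G) v = nbr_count G (pverts G) v"
proof -
  interpret pair_graph G by fact
  have "out_arcs (with_proj G) v = Pair v ` {w \<in> pverts G. (v, w) \<in> parcs G}"
    by (auto simp: out_arcs_def dest: in_arcsD2)
  then show ?thesis
    by (simp add: out_degree_def nbr_count_def card_image inj_on_def)
qed

lemma max_degree_eq: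
  assumes "pair_graph G"
  shows "max_degree G = Max (nbr_count G (pverts G) ` pverts G)"
  unfolding max_degree_def out_degree_eq_nbr_count[OF assms] ..

text \<open>Counting the neighbours inside \<open>S\<close> twice removes the complement from the definition, leaving
  only quantities that are additive under Cartesian products.\<close>

lemma defensive_alliance_iff_degree:
  assumes "pair_graph G"
  shows "defensive_alliance G k S \<longleftrightarrow>
     \<bar>k\<bar> \<le> int (max_degree G) \<and> S \<noteq> {} \<and> S \<subseteq> pverts G \<and>
     (\<forall>v\<in>S. int (nbr_count G (pverts G) v) + k \<le> 2 * int (nbr_count G S v))"
proof -
  have "int (nbr_count G (pverts G - S) v) + k \<le> int (nbr_count G S v) \<longleftrightarrow>
      int (nbr_count G (pverts G) v) + k \<le> 2 * int (nbr_count G S v)"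
    if "S \<subseteq> pverts G" for v
    using nbr_count_add_complement[OF assms that, of v] by linarith
  then show ?thesis
    unfolding defensive_alliance_def by (auto simp: abs_le_iff)
qed

section \<open>Alliances in a Cartesian product\<close>

lemma pverts_cartesian_product [simp]:
  "pverts (cartesian_product G H) = pverts G \<times> pverts H"
  by (simp add: cartesian_product_def)

text \<open>A neighbour of \<open>(u, v)\<close> differs from it in one coordinate only. The neighbours that keep \<open>v\<close>
  and those that keep \<open>u\<close> could meet only in \<open>(u, v)\<close> itself, which is excluded because there are
  no loops; so the two counts add up.\<close>

lemma nbr_count_cartesian_product:
  assumes G: "pair_graph G" and H: "pair_graph H"
    and S: "S \<subseteq> pverts G" and T: "T \<subseteq> pverts H" and "u \<in> S" and "v \<in> T"
  shows "nbr_count (cartesian_product G H) (S \<times> T) (u, v) = nbr_count G S u + nbr_count H T v"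
proof -
  interpret G: pair_graph G by fact
  interpret H: pair_graph H by fact
  let ?A = "{u' \<in> S. (u, u') \<in> parcs G}" and ?B = "{v' \<in> T. (v, v') \<in> parcs H}"
  have "{w \<in> S \<times> T. ((u, v), w) \<in> parcs (cartesian_product G H)} = ?A \<times> {v} \<union> {u} \<times> ?B"
    using assms by (auto simp: cartesian_product_def)
  moreover have "?A \<times> {v} \<inter> {u} \<times> ?B = {}"
    using G.pair_no_loops by fastforce
  ultimately show ?thesis
    unfolding nbr_count_def
    by (simp add: card_Un_disjoint finite_nbrs[OF G] finite_nbrs[OF H] card_cartesian_product)
qed

lemma max_degree_cartesian_product_ge:
  assumes G: "pair_graph G" and H: "pair_graph H"
    and "pverts G \<noteq> {}" and "pverts H \<noteq> {}"
  shows "max_degree G + max_degree H \<le> max_degree (cartesian_product G H)"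
proof -
  interpret G: pair_graph G by fact
  interpret H: pair_graph H by fact
  have "max_degree G \<in> nbr_count G (pverts G) ` pverts G"
    using assms by (simp add: max_degree_eq)
  then obtain u where u: "u \<in> pverts G" "max_degree G = nbr_count G (pverts G) u" by blast
  have "max_degree H \<in> nbr_count H (pverts H) ` pverts H"
    using assms by (simp add: max_degree_eq)
  then obtain v where v: "v \<in> pverts H" "max_degree H = nbr_count H (pverts H) v" by blast
  have "max_degree G + max_degree H =
      nbr_count (cartesian_product G H) (pverts G \<times> pverts H) (u, v)"
    using nbr_count_cartesian_product[OF G H order_refl order_refl u(1) v(1)] u v by simp
  also have "\<dots> \<le> max_degree (cartesian_product G H)"
    unfolding max_degree_eq[OF pair_graph_cartesian_product[OF G H]]
    using u v by (intro Max_ge) auto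
  finally show ?thesis .
qed

lemma defensive_alliance_Times:
  assumes G: "pair_graph G" and H: "pair_graph H"
    and S: "defensive_alliance G k S" and T: "defensive_alliance H l T"
  shows "defensive_alliance (cartesian_product G H) (k + l) (S \<times> T)"
proof -
  note S' = S[unfolded defensive_alliance_iff_degree[OF G]]
  note T' = T[unfolded defensive_alliance_iff_degree[OF H]]
  have sub: "S \<subseteq> pverts G" "T \<subseteq> pverts H" and ne: "S \<noteq> {}" "T \<noteq> {}"
    using S' T' by auto
  have "\<bar>k + l\<bar> \<le> int (max_degree (cartesian_product G H))"
    using max_degree_cartesian_product_ge[OF G H] sub ne S' T' by fastforce
  moreover have "int (nbr_count (cartesian_product G H) (pverts G \<times> pverts H) (u, v)) + (k + l)
      \<le> 2 * int (nbr_count (cartesian_product G H) (S \<times> T) (u, v))"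
    if "u \<in> S" "v \<in> T" for u v
  proof -
    have "int (nbr_count G (pverts G) u) + k \<le> 2 * int (nbr_count G S u)"
      "int (nbr_count H (pverts H) v) + l \<le> 2 * int (nbr_count H T v)"
      using S' T' that by auto
    then show ?thesis
      using that sub by (simp add: nbr_count_cartesian_product[OF G H] subset_iff)
  qed
  ultimately show ?thesis
    unfolding defensive_alliance_iff_degree[OF pair_graph_cartesian_product[OF G H]]
    using sub ne by auto
qed

section \<open>Products of partitions\<close>

lemma partition_on_Times:
  assumes P: "partition_on A P" and Q: "partition_on B Q"
  shows "partition_on (A \<times> B) ((\<lambda>(S, T). S \<times> T) ` (P \<times> Q))"
proof (rule partition_onI)
  show "\<Union> ((\<lambda>(S, T). S \<times> T) ` (P \<times> Q)) = A \<times> B"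
    using partition_onD1[OF P] partition_onD1[OF Q] by auto
next
  fix C D
  assume "C \<in> (\<lambda>(S, T). S \<times> T) ` (P \<times> Q)" "D \<in> (\<lambda>(S, T). S \<times> T) ` (P \<times> Q)" "C \<noteq> D"
  then obtain S T S' T' where *: "C = S \<times> T" "D = S' \<times> T'" "S \<in> P" "S' \<in> P" "T \<in> Q" "T' \<in> Q"
    and "S \<noteq> S' \<or> T \<noteq> T'" by auto
  then have "S \<inter> S' = {} \<or> T \<inter> T' = {}"
    using disjointD[OF partition_onD2[OF P]] disjointD[OF partition_onD2[OF Q]] by metis
  then show "disjnt C D"
    using * by (auto simp: disjnt_def)
next
  show "{} \<notin> (\<lambda>(S, T). S \<times> T) ` (P \<times> Q)"
    using partition_onD3[OF P] partition_onD3[OF Q] by (auto dest!: sym[of "{}"])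
qed

text \<open>Blocks are nonempty, so a box determines its two sides.\<close>

lemma card_partition_Times:
  assumes P: "partition_on A P" and Q: "partition_on B Q"
  shows "card ((\<lambda>(S, T). S \<times> T) ` (P \<times> Q)) = card P * card Q"
proof -
  have "inj_on (\<lambda>(S, T). S \<times> T) (P \<times> Q)"
    using partition_onD3[OF P] partition_onD3[OF Q]
    by (auto simp: inj_on_def times_eq_iff)
  then show ?thesis
    by (simp add: card_image card_cartesian_product)
qed

lemma defensive_alliance_partition_Times:
  assumes "pair_graph G" and "pair_graph H"
    and "defensive_alliance_partition G k P" and "defensive_alliance_partition H l Q"
  shows "defensive_alliance_partition (cartesian_product G H) (k + l)
      ((\<lambda>(S, T). S \<times> T) ` (P \<times> Q))"
  using assms
  by (auto simp: defensive_alliance_partition_def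
      intro: partition_on_Times defensive_alliance_Times)

section \<open>The extremal numbers\<close>

lemma finite_defensive_alliances:
  assumes "pair_graph G"
  shows "finite {S. defensive_alliance G k S}"
proof -
  interpret pair_graph G by fact
  have "{S. defensive_alliance G k S} \<subseteq> Pow (pverts G)"
    by (auto simp: defensive_alliance_def)
  then show ?thesis using finite_subset pair_finite_verts by blast
qed

lemma finite_defensive_alliance_partitions:
  assumes "pair_graph G"
  shows "finite {P. defensive_alliance_partition G k P}"
proof -
  have "{P. defensive_alliance_partition G k P} \<subseteq> Pow {S. defensive_alliance G k S}"
    by (auto simp: defensive_alliance_partition_def)
  then show ?thesis using finite_subset finite_defensive_alliances[OF assms] by blast
qed

lemma defensive_alliance_number_le:
  assumes "pair_graph G" and "defensive_alliance G k S"
  shows "defensive_alliance_number k G \<le> card S"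
  unfolding defensive_alliance_number_def
  using assms finite_defensive_alliances by (intro Min_le) auto

lemma defensive_alliance_number_attained:
  assumes "pair_graph G" and "\<exists>S. defensive_alliance G k S"
  obtains S where "defensive_alliance G k S" "card S = defensive_alliance_number k G"
proof -
  have "defensive_alliance_number k G \<in> card ` {S. defensive_alliance G k S}"
    unfolding defensive_alliance_number_def
    using assms finite_defensive_alliances by (intro Min_in) auto
  then show ?thesis using that by auto
qed

lemma defensive_alliance_partition_number_ge:
  assumes "pair_graph G" and "defensive_alliance_partition G k P"
  shows "card P \<le> defensive_alliance_partition_number k G"
  unfolding defensive_alliance_partition_number_def
  using assms finite_defensive_alliance_partitions by (intro Max_ge) auto

lemma defensive_alliance_partition_number_attained:
  assumes "pair_graph G" and "\<exists>P. defensive_alliance_partition G k P"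
  obtains P where "defensive_alliance_partition G k P"
    "card P = defensive_alliance_partition_number k G"
proof -
  have "defensive_alliance_partition_number k G \<in> card ` {P. defensive_alliance_partition G k P}"
    unfolding defensive_alliance_partition_number_def
    using assms finite_defensive_alliance_partitions by (intro Max_in) auto
  then show ?thesis using that by auto
qed

theorem theorem12:
  fixes G1 :: "'a pair_pre_digraph" and G2 :: "'b pair_pre_digraph"
    and k1 k2 :: int
  assumes "pair_graph G1" and "pair_graph G2"
  shows
    "((\<exists>S. defensive_alliance G1 k1 S) \<and> (\<exists>S. defensive_alliance G2 k2 S) \<longrightarrow>
        (\<exists>S. defensive_alliance (cartesian_product G1 G2) (k1 + k2) S) \<and>
        defensive_alliance_number (k1 + k2) (cartesian_product G1 G2)
          \<le> defensive_alliance_number k1 G1 * defensive_alliance_number k2 G2)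
     \<and>
     ((\<exists>P. defensive_alliance_partition G1 k1 P) \<and> (\<exists>P. defensive_alliance_partition G2 k2 P) \<longrightarrow>
        (\<exists>P. defensive_alliance_partition (cartesian_product G1 G2) (k1 + k2) P) \<and>
        defensive_alliance_partition_number (k1 + k2) (cartesian_product G1 G2)
          \<ge> defensive_alliance_partition_number k1 G1 * defensive_alliance_partition_number k2 G2)"
proof (intro conjI impI; elim conjE)
  note prod = pair_graph_cartesian_product[OF assms]
  {
    assume "\<exists>S. defensive_alliance G1 k1 S" "\<exists>S. defensive_alliance G2 k2 S"
    then obtain S T where
      S: "defensive_alliance G1 k1 S" "card S = defensive_alliance_number k1 G1" and
      T: "defensive_alliance G2 k2 T" "card T = defensive_alliance_number k2 G2"
      using defensive_alliance_number_attained assms by metis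
    have ST: "defensive_alliance (cartesian_product G1 G2) (k1 + k2) (S \<times> T)"
      using defensive_alliance_Times[OF assms S(1) T(1)] .
    then show "\<exists>S. defensive_alliance (cartesian_product G1 G2) (k1 + k2) S" ..
    show "defensive_alliance_number (k1 + k2) (cartesian_product G1 G2)
        \<le> defensive_alliance_number k1 G1 * defensive_alliance_number k2 G2"
      using defensive_alliance_number_le[OF prod ST] S T by (simp add: card_cartesian_product)
  next
    assume "\<exists>P. defensive_alliance_partition G1 k1 P" "\<exists>P. defensive_alliance_partition G2 k2 P"
    then obtain P Q where
      P: "defensive_alliance_partition G1 k1 P"
        "card P = defensive_alliance_partition_number k1 G1" and
      Q: "defensive_alliance_partition G2 k2 Q"
        "card Q = defensive_alliance_partition_number k2 G2"
      using defensive_alliance_partition_number_attained assms by metis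
    let ?R = "(\<lambda>(S, T). S \<times> T) ` (P \<times> Q)"
    have R: "defensive_alliance_partition (cartesian_product G1 G2) (k1 + k2) ?R"
      using defensive_alliance_partition_Times[OF assms P(1) Q(1)] .
    then show "\<exists>P. defensive_alliance_partition (cartesian_product G1 G2) (k1 + k2) P" ..
    have "card ?R = card P * card Q"
      using P Q card_partition_Times unfolding defensive_alliance_partition_def by blast
    then show "defensive_alliance_partition_number k1 G1 * defensive_alliance_partition_number k2 G2
        \<le> defensive_alliance_partition_number (k1 + k2) (cartesian_product G1 G2)"
      using defensive_alliance_partition_number_ge[OF prod R] P Q by simp
  }
qed

end
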